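(* There exists a universal constant $c>0$ such that for every $\varepsilon\in[0,1/4]$ and every positive integer $n$ there exists a subset $S\subset\mathbb{R}^n$, where $\mathbb{R}^n$ is equipped with the Euclidean metric, for which $$c_{\mathrm{UM}}(S)\le 1+3\varepsilon\qquad\text{and}\qquad \dim_H(S)\ge\frac{c\,\varepsilon^2}{\log(1/\varepsilon)}\,n ,$$ where for $\varepsilon=0$ the expression $\varepsilon^2/\log(1/\varepsilon)$ is interpreted as $0$.
   Context: An ultrametric on a set $X$ is a metric $\rho$ on $X$ satisfying $\rho(x,y)\le\max\{\rho(x,z),\rho(y,z)\}$ for all $x,y,z\in X$. The ultrametric distortion of a metric space $(X,d)$, written $c_{\mathrm{UM}}(X,d)$ or $c_{\mathrm{UM}}(X)$, is the infimum over $D$ such that there exists an ultrametric $\rho$ on $X$ satisfying $d(x,y)\le\rho(x,y)\le D\cdot d(x,y)$ for all $x,y\in X$. Subsets of $\mathbb{R}^n$ carry the induced metric. The diameter is $\operatorname{diam}(X)=\sup_{x,y\in X}d(x,y)$. For $\alpha>0$, the $\alpha$-Hausdorff content of $(X,d)$ is $\mathcal{C}^\alpha(X)=\inf\{\sum_{i\in\mathbb{N}}\operatorname{diam}(A_i)^\alpha:\ \bigcup_{i\in\mathbb{N}}A_i\supseteq X\}$, and the Hausdorff dimension is $\dim_H(X)=\inf\{\alpha>0:\ \mathcal{C}^\alpha(X)=0\}$. *)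

theory Defs
  imports "HOL-Analysis.Analysis"
begin

text \<open>
  The dimension has to be a quantified natural number, because the constant in the theorem must
  not depend on it; so \<open>\<real>\<^sup>n\<close> is represented as in \<^const>\<open>Euclidean_space\<close>,
  by the real sequences that vanish from index \<open>n\<close> on.
\<close>

definition euclid_carrier :: "nat \<Rightarrow> (nat \<Rightarrow> real) set" where
  "euclid_carrier n = topspace (Euclidean_space n)"

definition euclid_dist :: "nat \<Rightarrow> (nat \<Rightarrow> real) \<Rightarrow> (nat \<Rightarrow> real) \<Rightarrow> real" where
  "euclid_dist n x y = L2_set (\<lambda>i. x i - y i) {..<n}"

lemma Metric_space_euclid: "Metric_space (euclid_carrier n) (euclid_dist n)"
proof
  fix x y z :: "nat \<Rightarrow> real"
  show "0 \<le> euclid_dist n x y"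
    by (simp add: euclid_dist_def L2_set_nonneg)
  show "euclid_dist n x y = euclid_dist n y x"
    by (simp add: euclid_dist_def L2_set_def power2_commute)
  show "euclid_dist n x z \<le> euclid_dist n x y + euclid_dist n y z"
    using L2_set_triangle_ineq[of "\<lambda>i. x i - y i" "\<lambda>i. y i - z i" "{..<n}"]
    by (simp add: euclid_dist_def)
next
  fix x y :: "nat \<Rightarrow> real"
  assume xy: "x \<in> euclid_carrier n" "y \<in> euclid_carrier n"
  have "euclid_dist n x y = 0 \<longleftrightarrow> (\<forall>i<n. x i = y i)"
    by (auto simp: euclid_dist_def L2_set_eq_0_iff)
  also have "\<dots> \<longleftrightarrow> (\<forall>i. x i = y i)"
    using xy by (auto simp: euclid_carrier_def topspace_Euclidean_space) (metis leI)
  finally show "euclid_dist n x y = 0 \<longleftrightarrow> x = y"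
    by (simp add: fun_eq_iff)
qed

definition ultrametric_on :: "'a set \<Rightarrow> ('a \<Rightarrow> 'a \<Rightarrow> real) \<Rightarrow> bool" where
  "ultrametric_on X \<rho> \<longleftrightarrow>
     Metric_space X \<rho> \<and> (\<forall>x\<in>X. \<forall>y\<in>X. \<forall>z\<in>X. \<rho> x y \<le> max (\<rho> x z) (\<rho> y z))"

text \<open>
  The value is \<open>\<infinity>\<close> if no \<open>D\<close> is admissible. The bound \<open>1 \<le> D\<close> is automatic when
  \<open>X\<close> has two distinct points; it only gives spaces with at most one point the distortion 1.
\<close>

definition um_distortion :: "'a set \<Rightarrow> ('a \<Rightarrow> 'a \<Rightarrow> real) \<Rightarrow> ereal" where
  "um_distortion X d = Inf (ereal ` {D. 1 \<le> D \<and>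
     (\<exists>\<rho>. ultrametric_on X \<rho> \<and> (\<forall>x\<in>X. \<forall>y\<in>X. d x y \<le> \<rho> x y \<and> \<rho> x y \<le> D * d x y))})"

text \<open>
  Unbounded sets have diameter \<open>\<infinity>\<close>, unlike with \<^const>\<open>diameter\<close>, which gives them 0.
\<close>

definition ediam :: "('a \<Rightarrow> 'a \<Rightarrow> real) \<Rightarrow> 'a set \<Rightarrow> ennreal" where
  "ediam d A = (SUP x\<in>A. SUP y\<in>A. ennreal (d x y))"

text \<open>Only used for exponents \<open>\<alpha> > 0\<close>.\<close>

definition ennreal_powr :: "ennreal \<Rightarrow> real \<Rightarrow> ennreal" where
  "ennreal_powr t \<alpha> = (if t = \<infinity> then \<infinity> else ennreal (enn2real t powr \<alpha>))"

definition hausdorff_content :: "real \<Rightarrow> 'a set \<Rightarrow> ('a \<Rightarrow> 'a \<Rightarrow> real) \<Rightarrow> ennreal" where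
  "hausdorff_content \<alpha> X d =
     (INF A\<in>{A :: nat \<Rightarrow> 'a set. (\<forall>i. A i \<subseteq> X) \<and> X \<subseteq> (\<Union>i. A i)}.
        \<Sum>i. ennreal_powr (ediam d (A i)) \<alpha>)"

definition hausdorff_dim :: "'a set \<Rightarrow> ('a \<Rightarrow> 'a \<Rightarrow> real) \<Rightarrow> ereal" where
  "hausdorff_dim X d = Inf (ereal ` {\<alpha>. 0 < \<alpha> \<and> hausdorff_content \<alpha> X d = 0})"

end

theory Submission
  imports Defs "HOL-Probability.Infinite_Product_Measure"
begin

text \<open>
  The set is a self-similar Cantor set \<open>S = {\<Sum>k. r ^ k * v\<^sub>k | v\<^sub>k \<in> V}\<close> whose digits come from a finite
  set \<open>V\<close> of points that are equidistant up to a factor \<open>1 + \<epsilon>\<close>, with contraction ratio \<open>r = \<epsilon>\<^sup>2\<close>.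

  If two digit sequences first differ at level \<open>k\<close>, then their points differ by \<open>r ^ k\<close> times a
  distance in \<open>V\<close>, up to a relative error of order \<open>r\<close> from the later digits
  (\<open>digit_point_dist_first_diff\<close>). So the distance on \<open>S\<close> is within a factor \<open>1 + 3 * \<epsilon>\<close> of an
  ultrametric depending only on \<open>k\<close> (\<open>um_distortion_le_of_coding\<close>). The same estimate makes \<open>S\<close> behave
  like a full \<open>card V\<close>-ary tree with scales \<open>r ^ k\<close>, so that its dimension is at least
  \<open>ln (card V) / ln (1/r)\<close> (\<open>hausdorff_dim_ge_of_coding\<close>).

  What makes this dimension large is that \<open>n\<close>-space has room for exponentially many nearly equidistant points:
  two random sign vectors have correlation at most \<open>\<epsilon>/2 * n\<close> except with probability exponentially
  small in \<open>\<epsilon>\<^sup>2 * n\<close>, so a maximal family of such vectors gives \<open>V\<close> with \<open>ln (card V)\<close> at least a constant times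
  \<open>\<epsilon>\<^sup>2 * n\<close> (\<open>nearly_equidistant_points\<close>). Division by \<open>ln (1/r) = 2 * ln (1/\<epsilon>)\<close> gives the bound.
\<close>

section \<open>Exponentially many nearly equidistant points\<close>

definition sign_cube :: "nat \<Rightarrow> (nat \<Rightarrow> real) set" where
  "sign_cube n = {..<n} \<rightarrow>\<^sub>E {-1, 1}"

lemma finite_sign_cube: "finite (sign_cube n)"
  and card_sign_cube: "card (sign_cube n) = 2 ^ n"
  by (simp_all add: sign_cube_def finite_PiE card_PiE numeral_2_eq_2)

lemma sign_cube_sign: "x \<in> sign_cube n \<Longrightarrow> i < n \<Longrightarrow> x i \<in> {-1, 1}"
  by (auto simp: sign_cube_def PiE_iff)

text \<open>
  The moment generating function of a random sign. The weaker exponent \<open>t\<^sup>2\<close> in place of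
  \<open>t\<^sup>2 / 2\<close> costs only a constant factor below and reduces the proof to quadratic Taylor bounds.
\<close>

lemma exp_add_exp_minus_le:
  fixes t :: real
  assumes "0 \<le> t" "t \<le> 1"
  shows "exp t + exp (- t) \<le> 2 * exp (t\<^sup>2)"
proof -
  have "1 \<le> (1 + t + t\<^sup>2 / 2) * (1 - t + t\<^sup>2)"
  proof -
    have "(1 + t + t\<^sup>2 / 2) * (1 - t + t\<^sup>2) = 1 + (t\<^sup>2 + t^3 + t^4) / 2"
      by (simp add: field_simps power2_eq_square power3_eq_cube power4_eq_xxxx)
    then show ?thesis using assms by simp
  qed
  also have "\<dots> \<le> exp t * (1 - t + t\<^sup>2)"
    using assms by (intro mult_right_mono exp_lower_Taylor_quadratic) auto
  finally have "exp (- t) \<le> 1 - t + t\<^sup>2"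
    by (simp add: exp_minus field_simps)
  moreover have "exp t \<le> 1 + t + t\<^sup>2"
    by (rule exp_bound) fact+
  moreover have "1 + t\<^sup>2 \<le> exp (t\<^sup>2)"
    by (rule exp_ge_add_one_self)
  ultimately show ?thesis by linarith
qed

text \<open>
  Chernoff's argument as a count: each \<open>x\<close> in the set contributes at least \<open>exp (t * \<delta> * n)\<close> to the
  exponential sum over the cube, and that sum factors over the coordinates. Since \<open>y i\<close> is a sign,
  every factor is \<open>exp t + exp (-t)\<close>; the value \<open>t = \<delta> / 2\<close> minimises the resulting exponent
  \<open>t\<^sup>2 * n - t * \<delta> * n\<close>.
\<close>

lemma card_large_correlation_le:
  fixes y :: "nat \<Rightarrow> real"
  assumes y: "\<And>i. i < n \<Longrightarrow> y i \<in> {-1, 1}" and \<delta>: "0 \<le> \<delta>" "\<delta> \<le> 2"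
  shows "real (card {x \<in> sign_cube n. (\<Sum>i<n. x i * y i) > \<delta> * n}) \<le> 2 ^ n * exp (- (\<delta>\<^sup>2 * n / 4))"
    (is "real (card ?B) \<le> _")
proof -
  define t where "t = \<delta> / 2"
  have t: "0 \<le> t" "t \<le> 1" using \<delta> by (auto simp: t_def)
  have "real (card ?B) * exp (t * \<delta> * n) = (\<Sum>x\<in>?B. exp (t * \<delta> * n))"
    by simp
  also have "\<dots> \<le> (\<Sum>x\<in>?B. exp (t * (\<Sum>i<n. x i * y i)))"
    using t by (intro sum_mono) (auto intro!: mult_left_mono simp: mult.assoc)
  also have "\<dots> \<le> (\<Sum>x\<in>sign_cube n. exp (t * (\<Sum>i<n. x i * y i)))"
    by (intro sum_mono2) (auto simp: finite_sign_cube)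
  also have "\<dots> = (\<Sum>x\<in>sign_cube n. \<Prod>i<n. exp (t * (x i * y i)))"
    by (simp add: sum_distrib_left exp_sum)
  also have "\<dots> = (\<Prod>i<n. \<Sum>s\<in>{-1, 1}. exp (t * (s * y i)))"
    unfolding sign_cube_def by (rule prod_sum_PiE[symmetric]) auto
  also have "\<dots> = (\<Prod>i<n. exp t + exp (- t))"
  proof (intro prod.cong refl)
    fix i assume "i \<in> {..<n}"
    then have "y i = -1 \<or> y i = 1" using y[of i] by auto
    then show "(\<Sum>s\<in>{-1, 1}. exp (t * (s * y i))) = exp t + exp (- t)"
      by auto
  qed
  also have "\<dots> \<le> (2 * exp (t\<^sup>2)) ^ n"
    unfolding prod_constant card_lessThan
    by (intro power_mono exp_add_exp_minus_le t) (simp add: add_nonneg_nonneg)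
  also have "\<dots> = 2 ^ n * exp (n * t\<^sup>2)"
    by (simp add: power_mult_distrib exp_of_nat_mult)
  finally have "real (card ?B) \<le> 2 ^ n * exp (n * t\<^sup>2) / exp (t * \<delta> * n)"
    by (simp add: pos_le_divide_eq)
  also have "\<dots> = 2 ^ n * exp (n * t\<^sup>2 - t * \<delta> * n)"
    by (simp add: exp_diff)
  also have "n * t\<^sup>2 - t * \<delta> * n = - (\<delta>\<^sup>2 * n / 4)"
    by (simp add: t_def field_simps power2_eq_square)
  finally show ?thesis .
qed

lemma card_large_abs_correlation_le:
  fixes y :: "nat \<Rightarrow> real"
  assumes y: "\<And>i. i < n \<Longrightarrow> y i \<in> {-1, 1}" and \<delta>: "0 \<le> \<delta>" "\<delta> \<le> 2"
  shows "real (card {x \<in> sign_cube n. \<bar>\<Sum>i<n. x i * y i\<bar> > \<delta> * n})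
    \<le> 2 * (2 ^ n * exp (- (\<delta>\<^sup>2 * n / 4)))"
proof -
  let ?B = "\<lambda>y. {x \<in> sign_cube n. (\<Sum>i<n. x i * y i) > \<delta> * n}"
  have "{x \<in> sign_cube n. \<bar>\<Sum>i<n. x i * y i\<bar> > \<delta> * n} = ?B y \<union> ?B (\<lambda>i. - y i)"
    by (auto simp: sum_negf)
  then have "card {x \<in> sign_cube n. \<bar>\<Sum>i<n. x i * y i\<bar> > \<delta> * n} \<le> card (?B y) + card (?B (\<lambda>i. - y i))"
    by (simp add: card_Un_le)
  then have "real (card {x \<in> sign_cube n. \<bar>\<Sum>i<n. x i * y i\<bar> > \<delta> * n})
      \<le> real (card (?B y)) + real (card (?B (\<lambda>i. - y i)))"
    by linarith
  moreover have "real (card (?B y)) \<le> 2 ^ n * exp (- (\<delta>\<^sup>2 * n / 4))"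
    using y \<delta> by (intro card_large_correlation_le)
  moreover have "real (card (?B (\<lambda>i. - y i))) \<le> 2 ^ n * exp (- (\<delta>\<^sup>2 * n / 4))"
    using y \<delta> by (intro card_large_correlation_le) force+
  ultimately show ?thesis by linarith
qed

text \<open>
  Gilbert--Varshamov: in a maximal family with small pairwise correlations, every vertex of the cube
  is strongly correlated with some member, so the exceptional sets of the members cover the cube, and
  the count above bounds the number of members from below.
\<close>

lemma nearly_orthogonal_signs:
  assumes n: "n \<ge> 1" and \<delta>: "0 \<le> \<delta>" "\<delta> < 1"
  obtains C where "C \<subseteq> sign_cube n" "real (card C) \<ge> exp (\<delta>\<^sup>2 * n / 4) / 2"
    "\<And>x y. x \<in> C \<Longrightarrow> y \<in> C \<Longrightarrow> x \<noteq> y \<Longrightarrow> \<bar>\<Sum>i<n. x i * y i\<bar> \<le> \<delta> * n"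
proof -
  let ?far = "\<lambda>x y :: nat \<Rightarrow> real. \<bar>\<Sum>i<n. x i * y i\<bar> \<le> \<delta> * n"
  let ?bad = "\<lambda>y :: nat \<Rightarrow> real. {x \<in> sign_cube n. \<bar>\<Sum>i<n. x i * y i\<bar> > \<delta> * n}"
  define F where "F = {C. C \<subseteq> sign_cube n \<and> pairwise ?far C}"
  have "finite F"
    by (rule finite_subset[of _ "Pow (sign_cube n)"]) (auto simp: F_def finite_sign_cube)
  moreover have "{} \<in> F" by (simp add: F_def)
  ultimately obtain C where C: "C \<in> F" and maximal: "\<And>C'. C' \<in> F \<Longrightarrow> C \<subseteq> C' \<Longrightarrow> C = C'"
    using finite_has_maximal[of F] by blast
  have finC: "finite C"
    using C finite_sign_cube finite_subset by (auto simp: F_def)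
  have "sign_cube n \<subseteq> (\<Union>y\<in>C. ?bad y)"
  proof
    fix x assume x: "x \<in> sign_cube n"
    show "x \<in> (\<Union>y\<in>C. ?bad y)"
    proof (rule ccontr)
      assume "x \<notin> (\<Union>y\<in>C. ?bad y)"
      then have far: "?far x y" if "y \<in> C" for y
        using x that by (auto simp: not_less)
      then have "insert x C \<in> F"
        using C x by (auto simp: F_def pairwise_insert mult.commute)
      then have "x \<in> C" using maximal by blast
      \<comment> \<open>A member is strongly correlated with itself; this is where \<open>\<delta> < 1\<close> and \<open>n \<ge> 1\<close> enter.\<close>
      have "(\<Sum>i<n. x i * x i) = (\<Sum>i<n. 1)"
        using sign_cube_sign[OF x] by (intro sum.cong) force+
      then show False
        using far[OF \<open>x \<in> C\<close>] n \<delta> by (simp add: not_le)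
    qed
  qed
  then have "card (sign_cube n) \<le> card (\<Union>y\<in>C. ?bad y)"
    by (intro card_mono) (auto simp: finC finite_sign_cube)
  also have "\<dots> \<le> (\<Sum>y\<in>C. card (?bad y))"
    by (rule card_UN_le[OF finC])
  finally have "2 ^ n \<le> (\<Sum>y\<in>C. real (card (?bad y)))"
    by (simp add: card_sign_cube flip: of_nat_sum of_nat_le_iff)
  also have "\<dots> \<le> (\<Sum>y\<in>C. 2 * (2 ^ n * exp (- (\<delta>\<^sup>2 * n / 4))))"
    using C \<delta> by (intro sum_mono card_large_abs_correlation_le sign_cube_sign) (auto simp: F_def)
  finally have "1 \<le> real (card C) * (2 * exp (- (\<delta>\<^sup>2 * n / 4)))"
    by simp
  then have "real (card C) \<ge> exp (\<delta>\<^sup>2 * n / 4) / 2"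
    by (simp add: exp_minus field_simps)
  with C show thesis
    by (intro that[of C]) (auto simp: F_def pairwise_def)
qed

text \<open>
  Sign vectors with correlation at most \<open>\<epsilon>/2 * n\<close> in absolute value have squared distances between
  \<open>2 * n * (1 - \<epsilon>/2)\<close> and \<open>2 * n * (1 + \<epsilon>/2)\<close>; this converts that ratio to one of distances.
\<close>

lemma sqrt_ratio_le:
  fixes \<epsilon> :: real
  assumes "0 \<le> \<epsilon>" "\<epsilon> \<le> 1/4"
  shows "sqrt (1 + \<epsilon>/2) \<le> (1 + \<epsilon>) * sqrt (1 - \<epsilon>/2)"
proof (rule real_le_lsqrt)
  have "\<epsilon> * \<epsilon> \<le> 1 * 1" using assms by (intro mult_mono) auto
  then have "0 \<le> \<epsilon> * (1 - \<epsilon> * \<epsilon> / 2)" using assms by (intro mult_nonneg_nonneg) auto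
  moreover have "((1 + \<epsilon>) * sqrt (1 - \<epsilon>/2))\<^sup>2 = (1 + \<epsilon>)\<^sup>2 * (1 - \<epsilon>/2)"
    using assms by (simp add: power_mult_distrib)
  moreover have "(1 + \<epsilon>)\<^sup>2 * (1 - \<epsilon>/2) = 1 + \<epsilon>/2 + \<epsilon> * (1 - \<epsilon> * \<epsilon> / 2)"
    by (simp add: field_simps power2_eq_square)
  ultimately show "1 + \<epsilon>/2 \<le> ((1 + \<epsilon>) * sqrt (1 - \<epsilon>/2))\<^sup>2" by linarith
qed (use assms in auto)

text \<open>
  For large \<open>\<epsilon>\<^sup>2 * n\<close> these are nearly orthogonal sign vectors. The factor \<open>1/2\<close> in their number
  makes that bound void for small \<open>\<epsilon>\<^sup>2 * n\<close>; there any two points are exactly equidistant and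
  \<open>ln 2\<close> is already large enough.
\<close>

lemma nearly_equidistant_points:
  assumes n: "n \<ge> 1" and \<epsilon>: "0 \<le> \<epsilon>" "\<epsilon> \<le> 1/4"
  obtains V m where "V \<subseteq> euclid_carrier n" "finite V" "card V \<ge> 2" "ln (card V) \<ge> \<epsilon>\<^sup>2 * n / 32"
    "m > 0"
    "\<And>v w. v \<in> V \<Longrightarrow> w \<in> V \<Longrightarrow> v \<noteq> w \<Longrightarrow> m \<le> euclid_dist n v w \<and> euclid_dist n v w \<le> (1 + \<epsilon>) * m"
proof (cases "\<epsilon>\<^sup>2 * n / 32 \<le> ln 2")
  case True
  define e :: "nat \<Rightarrow> real" where "e = (\<lambda>i. if i = 0 then 1 else 0)"
  have "e 0 = 1" by (simp add: e_def)
  then have ne: "e \<noteq> (\<lambda>_. 0)" by auto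
  have d: "euclid_dist n (\<lambda>_. 0) e = 1"
  proof -
    have "(\<Sum>i<n. (e i)\<^sup>2) = (\<Sum>i<n. if i = 0 then 1 else 0)"
      by (intro sum.cong) (auto simp: e_def)
    also have "\<dots> = 1" using n by simp
    finally show ?thesis by (simp add: euclid_dist_def L2_set_def)
  qed
  interpret Metric_space "euclid_carrier n" "euclid_dist n" by (rule Metric_space_euclid)
  show thesis
  proof (rule that[of "{\<lambda>_. 0, e}" 1])
    show "{\<lambda>_. 0, e} \<subseteq> euclid_carrier n"
      using n by (auto simp: euclid_carrier_def topspace_Euclidean_space e_def)
    show "ln (real (card {\<lambda>_. 0, e})) \<ge> \<epsilon>\<^sup>2 * n / 32"
      using True ne by simp
    show "1 \<le> euclid_dist n v w \<and> euclid_dist n v w \<le> (1 + \<epsilon>) * 1"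
      if "v \<in> {\<lambda>_. 0, e}" "w \<in> {\<lambda>_. 0, e}" "v \<noteq> w" for v w
      using that d commute[of "\<lambda>_. 0" e] \<epsilon> by auto
  qed (use ne in auto)
next
  case False
  obtain C where C: "C \<subseteq> sign_cube n" "real (card C) \<ge> exp ((\<epsilon>/2)\<^sup>2 * n / 4) / 2"
    and far: "\<And>x y. x \<in> C \<Longrightarrow> y \<in> C \<Longrightarrow> x \<noteq> y \<Longrightarrow> \<bar>\<Sum>i<n. x i * y i\<bar> \<le> \<epsilon>/2 * n"
    using nearly_orthogonal_signs[OF n, of "\<epsilon>/2"] \<epsilon> by auto
  define emb :: "(nat \<Rightarrow> real) \<Rightarrow> nat \<Rightarrow> real" where "emb x = (\<lambda>i. if i < n then x i else 0)" for x
  define m where "m = sqrt (2 * n * (1 - \<epsilon>/2))"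
  have inj: "inj_on emb C"
  proof (rule inj_onI)
    fix x y assume xy: "x \<in> C" "y \<in> C" "emb x = emb y"
    then have "x \<in> extensional {..<n}" "y \<in> extensional {..<n}"
      using C(1) by (auto simp: sign_cube_def PiE_def)
    moreover have "x i = y i" if "i < n" for i
      using fun_cong[OF xy(3), of i] that by (simp add: emb_def)
    ultimately show "x = y" by (intro extensionalityI[of x "{..<n}" y]) auto
  qed
  have dist: "m \<le> euclid_dist n (emb x) (emb y) \<and> euclid_dist n (emb x) (emb y) \<le> (1 + \<epsilon>) * m"
    if "x \<in> C" "y \<in> C" "x \<noteq> y" for x y
  proof -
    let ?c = "\<Sum>i<n. x i * y i"
    have "(\<Sum>i<n. (emb x i - emb y i)\<^sup>2) = (\<Sum>i<n. 2 - 2 * (x i * y i))"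
    proof (intro sum.cong refl)
      fix i assume "i \<in> {..<n}"
      then have "x i \<in> {-1, 1}" "y i \<in> {-1, 1}" "i < n"
        using sign_cube_sign C(1) that by blast+
      then show "(emb x i - emb y i)\<^sup>2 = 2 - 2 * (x i * y i)"
        by (auto simp: emb_def)
    qed
    also have "\<dots> = 2 * n - 2 * ?c"
      by (simp add: sum_subtractf sum_distrib_left)
    finally have eq: "euclid_dist n (emb x) (emb y) = sqrt (2 * n - 2 * ?c)"
      by (simp add: euclid_dist_def L2_set_def)
    have c: "\<bar>?c\<bar> \<le> \<epsilon>/2 * n" using far that by blast
    have "sqrt (2 * n - 2 * ?c) \<le> sqrt (2 * n * (1 + \<epsilon>/2))"
      using c by (intro real_sqrt_le_mono) (auto simp: algebra_simps)
    also have "\<dots> \<le> sqrt (2 * n) * ((1 + \<epsilon>) * sqrt (1 - \<epsilon>/2))"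
      unfolding real_sqrt_mult[of "2 * n"] by (intro mult_left_mono sqrt_ratio_le \<epsilon>) auto
    also have "\<dots> = (1 + \<epsilon>) * m" by (simp add: m_def real_sqrt_mult)
    finally have "euclid_dist n (emb x) (emb y) \<le> (1 + \<epsilon>) * m" by (simp add: eq)
    moreover have "m \<le> euclid_dist n (emb x) (emb y)"
      unfolding eq m_def using c by (intro real_sqrt_le_mono) (auto simp: algebra_simps)
    ultimately show ?thesis by simp
  qed
  \<comment> \<open>Half of the exponent pays for the factor \<open>1/2\<close> in the number of vectors.\<close>
  have "exp (\<epsilon>\<^sup>2 * n / 32) * 2 \<le> exp (\<epsilon>\<^sup>2 * n / 32) * exp (\<epsilon>\<^sup>2 * n / 32)"
    using False exp_le_cancel_iff[of "ln 2" "\<epsilon>\<^sup>2 * n / 32"]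
    by (intro mult_left_mono) auto
  also have "\<dots> = exp ((\<epsilon>/2)\<^sup>2 * n / 4)"
    by (simp add: power_divide flip: exp_add)
  finally have big: "exp (\<epsilon>\<^sup>2 * n / 32) \<le> card C" using C(2) by linarith
  then have two: "2 < real (card C)"
    using False exp_less_cancel_iff[of "ln 2" "\<epsilon>\<^sup>2 * n / 32"] by simp
  have card: "card (emb ` C) = card C" using inj by (rule card_image)
  show thesis
  proof (rule that[of "emb ` C" m])
    show "emb ` C \<subseteq> euclid_carrier n"
      by (auto simp: euclid_carrier_def topspace_Euclidean_space emb_def)
    show "finite (emb ` C)"
      using two by (intro finite_imageI card_ge_0_finite) auto
    show "card (emb ` C) \<ge> 2" using two card by simp
    show "ln (card (emb ` C)) \<ge> \<epsilon>\<^sup>2 * n / 32"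
      using big two unfolding card by (subst ln_ge_iff) auto
    show "m > 0" using n \<epsilon> by (simp add: m_def)
    show "m \<le> euclid_dist n v w \<and> euclid_dist n v w \<le> (1 + \<epsilon>) * m"
      if "v \<in> emb ` C" "w \<in> emb ` C" "v \<noteq> w" for v w
      using that dist by blast
  qed
qed

section \<open>Dimension and distortion of sets coded by a tree\<close>

definition first_diff :: "(nat \<Rightarrow> 'b) \<Rightarrow> (nat \<Rightarrow> 'b) \<Rightarrow> nat \<Rightarrow> bool" where
  "first_diff \<omega> \<omega>' k \<longleftrightarrow> (\<forall>i<k. \<omega> i = \<omega>' i) \<and> \<omega> k \<noteq> \<omega>' k"

lemma first_diff_exists:
  assumes "\<omega> \<noteq> \<omega>'"
  obtains k where "first_diff \<omega> \<omega>' k"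
proof -
  from assms have "\<exists>k. \<omega> k \<noteq> \<omega>' k" by auto
  from LeastI_ex[OF this] show thesis
    by (intro that[of "LEAST k. \<omega> k \<noteq> \<omega>' k"]) (auto simp: first_diff_def dest: not_less_Least)
qed

lemma first_diff_ultra:
  "first_diff x y k \<Longrightarrow> first_diff x z l \<Longrightarrow> first_diff y z m \<Longrightarrow> min l m \<le> k"
  unfolding first_diff_def by (metis min_less_iff_conj not_le)

lemma ennreal_powr_mono: "s \<le> t \<Longrightarrow> 0 \<le> \<alpha> \<Longrightarrow> ennreal_powr s \<alpha> \<le> ennreal_powr t \<alpha>"
  by (auto simp: ennreal_powr_def top_unique less_top intro!: ennreal_leI powr_mono2 enn2real_mono)

lemma ennreal_powr_ennreal: "0 \<le> x \<Longrightarrow> ennreal_powr (ennreal x) \<alpha> = ennreal (x powr \<alpha>)"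
  by (simp add: ennreal_powr_def)

lemma dist_le_ediam: "x \<in> A \<Longrightarrow> y \<in> A \<Longrightarrow> ennreal (d x y) \<le> ediam d A"
  unfolding ediam_def by (meson SUP_upper2 order_refl)

text \<open>
  The mass distribution principle for the uniform product measure on the codes, which gives a cylinder
  of level \<open>k\<close> the mass \<open>1 / N ^ k\<close>, where \<open>N = card V\<close>. Let \<open>k\<close> be the first level at which two codes
  of points of \<open>A\<close> differ. Then the codes of \<open>A\<close> lie in one cylinder of level \<open>k\<close>, whereas the
  diameter of \<open>A\<close> is at least \<open>a * r ^ k\<close>. For \<open>\<alpha>\<close> below \<open>ln N / ln (1/r)\<close> the mass \<open>1 / N ^ k\<close> is
  at most \<open>(r ^ k) powr \<alpha>\<close>, that is, at most a constant times the \<open>\<alpha>\<close>-th power of the diameter. A cover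
  of the whole set must carry total mass 1, so its content cannot be arbitrarily small.

  Enlarging the codes of \<open>A\<close> to a cylinder also avoids any question of measurability of \<open>A\<close>.
\<close>

lemma hausdorff_dim_ge_of_coding:
  fixes d :: "'a \<Rightarrow> 'a \<Rightarrow> real" and \<phi> :: "(nat \<Rightarrow> 'b) \<Rightarrow> 'a"
  assumes V: "finite V" "card V \<ge> 2" and r: "0 < r" "r < 1" and a: "0 < a"
    and lower: "\<And>\<omega> \<omega>' k. \<omega> \<in> UNIV \<rightarrow> V \<Longrightarrow> \<omega>' \<in> UNIV \<rightarrow> V \<Longrightarrow> first_diff \<omega> \<omega>' k \<Longrightarrow>
      a * r ^ k \<le> d (\<phi> \<omega>) (\<phi> \<omega>')"
  shows "ereal (ln (card V) / ln (1 / r)) \<le> hausdorff_dim (\<phi> ` (UNIV \<rightarrow> V)) d"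
proof -
  let ?\<Omega> = "UNIV \<rightarrow> V :: (nat \<Rightarrow> 'b) set"
  define N where "N = real (card V)"
  have N: "2 \<le> N" and Vne: "V \<noteq> {}" using V by (auto simp: N_def)
  interpret product_prob_space "\<lambda>_. uniform_count_measure V" "UNIV :: nat set"
    using V Vne prob_space_uniform_count_measure[of V]
    by (intro product_prob_spaceI) auto
  define P where "P = (\<Pi>\<^sub>M i\<in>(UNIV :: nat set). uniform_count_measure V)"
  interpret prob_space P unfolding P_def by unfold_locales
  have space: "space P = ?\<Omega>"
    by (simp add: P_def space_PiM space_uniform_count_measure PiE_UNIV_domain)
  define cyl where "cyl \<omega> k = {\<omega>' \<in> space P. \<forall>i\<in>{..<k}. \<omega>' i \<in> {\<omega> i}}" for \<omega> :: "nat \<Rightarrow> 'b" and k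
  have cyl_sets: "cyl \<omega> k \<in> sets P" for \<omega> k
    unfolding cyl_def P_def
    by (intro sets.sets_Collect_finite_All sets_Collect_single')
      (auto simp: sets_uniform_count_measure space_uniform_count_measure)
  have emeasure_cyl: "emeasure P (cyl \<omega> k) = ennreal ((1 / N) ^ k)" if "\<omega> \<in> ?\<Omega>" for \<omega> k
  proof -
    have "emeasure (uniform_count_measure V) {\<omega> i} = ennreal (1 / N)" for i
      using that V by (subst emeasure_uniform_count_measure) (auto simp: N_def)
    then show ?thesis
      unfolding cyl_def P_def using that N
      by (subst emeasure_PiM_Collect) (auto simp: sets_uniform_count_measure prod_ennreal simp flip: ennreal_power)
  qed
  \<comment> \<open>The additive \<open>e\<close> is needed for sets with at most one point, whose diameter is 0 while every
    cylinder has positive mass.\<close>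
  have small_cylinder: "\<exists>C\<in>sets P. {\<omega> \<in> ?\<Omega>. \<phi> \<omega> \<in> A} \<subseteq> C \<and>
      emeasure P C \<le> ennreal (a powr - \<alpha>) * ennreal_powr (ediam d A) \<alpha> + ennreal e"
    if \<alpha>: "0 < \<alpha>" "\<alpha> < ln N / ln (1 / r)" and e: "0 < e" for \<alpha> A and e :: real
  proof (cases "\<exists>\<omega>\<^sub>0\<in>?\<Omega>. {\<omega> \<in> ?\<Omega>. \<phi> \<omega> \<in> A} \<subseteq> {\<omega>\<^sub>0}")
    case True
    then obtain \<omega>\<^sub>0 where \<omega>\<^sub>0: "\<omega>\<^sub>0 \<in> ?\<Omega>" "{\<omega> \<in> ?\<Omega>. \<phi> \<omega> \<in> A} \<subseteq> {\<omega>\<^sub>0}" by blast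
    obtain k where "(1 / N) ^ k < e"
      using real_arch_pow_inv[OF e, of "1 / N"] N by auto
    then have "emeasure P (cyl \<omega>\<^sub>0 k) \<le> ennreal e"
      using emeasure_cyl[OF \<omega>\<^sub>0(1)] by (simp add: ennreal_leI)
    then have "emeasure P (cyl \<omega>\<^sub>0 k) \<le> ennreal (a powr - \<alpha>) * ennreal_powr (ediam d A) \<alpha> + ennreal e"
      by (rule order_trans) simp
    moreover have "{\<omega> \<in> ?\<Omega>. \<phi> \<omega> \<in> A} \<subseteq> cyl \<omega>\<^sub>0 k"
      using \<omega>\<^sub>0 by (auto simp: cyl_def space)
    ultimately show ?thesis using cyl_sets by blast
  next
    case False
    define T where "T = {\<omega> \<in> ?\<Omega>. \<phi> \<omega> \<in> A}"
    obtain v where "v \<in> V" using Vne by blast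
    then have "(\<lambda>_. v) \<in> ?\<Omega>" by simp
    with False obtain \<omega>1 where "\<omega>1 \<in> T" unfolding T_def by blast
    with False obtain \<omega>2 where "\<omega>2 \<in> T" "\<omega>1 \<noteq> \<omega>2" unfolding T_def by blast
    define Q where "Q k \<longleftrightarrow> (\<exists>\<omega>\<in>T. \<exists>\<omega>'\<in>T. first_diff \<omega> \<omega>' k)" for k
    have "\<exists>k. Q k"
      using first_diff_exists[OF \<open>\<omega>1 \<noteq> \<omega>2\<close>] \<open>\<omega>1 \<in> T\<close> \<open>\<omega>2 \<in> T\<close> unfolding Q_def by metis
    \<comment> \<open>The first level at which \<open>T\<close> branches; it exists because \<open>T\<close> has two distinct elements.\<close>
    define k where "k = (LEAST k. Q k)"
    have "Q k" unfolding k_def using \<open>\<exists>k. Q k\<close> by (rule LeastI_ex)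
    then obtain \<omega> \<omega>' where \<omega>: "\<omega> \<in> T" "\<omega>' \<in> T" "first_diff \<omega> \<omega>' k" by (auto simp: Q_def)
    have "T \<subseteq> cyl \<omega> k"
    proof
      fix \<omega>'' assume "\<omega>'' \<in> T"
      have "\<omega>'' i = \<omega> i" if "i < k" for i
      proof (rule ccontr)
        assume "\<omega>'' i \<noteq> \<omega> i"
        then obtain l where l: "first_diff \<omega>'' \<omega> l" using first_diff_exists[of \<omega>'' \<omega>] by blast
        then have "l \<le> i" using \<open>\<omega>'' i \<noteq> \<omega> i\<close> by (metis first_diff_def not_le)
        moreover have "k \<le> l"
          unfolding k_def using l \<open>\<omega>'' \<in> T\<close> \<omega>(1) by (intro Least_le) (auto simp: Q_def)
        ultimately show False using that by simp
      qed
      then show "\<omega>'' \<in> cyl \<omega> k" using \<open>\<omega>'' \<in> T\<close> by (auto simp: cyl_def space T_def)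
    qed
    moreover have "emeasure P (cyl \<omega> k) \<le> ennreal (a powr - \<alpha>) * ennreal_powr (ediam d A) \<alpha> + ennreal e"
    proof -
      have "\<alpha> * ln (1 / r) < ln N"
        using \<alpha> r by (simp add: pos_less_divide_eq)
      then have "- ln N \<le> \<alpha> * ln r"
        using r by (simp add: ln_div)
      then have "exp (- ln N) \<le> r powr \<alpha>"
        using r by (simp add: powr_def)
      then have "1 / N \<le> r powr \<alpha>"
        using N by (simp add: exp_minus field_simps)
      then have "(1 / N) ^ k \<le> (r powr \<alpha>) ^ k"
        using N by (intro power_mono) auto
      also have "\<dots> = (r ^ k) powr \<alpha>"
        using r by (simp add: powr_powr mult.commute flip: powr_realpow)
      also have "\<dots> = a powr - \<alpha> * (a * r ^ k) powr \<alpha>"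
        using a r by (simp add: powr_mult powr_minus)
      finally have "emeasure P (cyl \<omega> k) \<le> ennreal (a powr - \<alpha> * (a * r ^ k) powr \<alpha>)"
        using emeasure_cyl[of \<omega> k] \<omega>(1) by (simp add: T_def ennreal_leI)
      also have "\<dots> = ennreal (a powr - \<alpha>) * ennreal_powr (ennreal (a * r ^ k)) \<alpha>"
        using ennreal_powr_ennreal[of "a * r ^ k" \<alpha>] a r by (simp add: ennreal_mult[of "a powr - \<alpha>"])
      also have "\<dots> \<le> ennreal (a powr - \<alpha>) * ennreal_powr (ediam d A) \<alpha>"
      proof (intro mult_left_mono ennreal_powr_mono)
        have "ennreal (a * r ^ k) \<le> ennreal (d (\<phi> \<omega>) (\<phi> \<omega>'))"
          using \<omega> by (intro ennreal_leI lower) (auto simp: T_def)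
        also have "\<dots> \<le> ediam d A"
          using \<omega> by (intro dist_le_ediam) (auto simp: T_def)
        finally show "ennreal (a * r ^ k) \<le> ediam d A" .
      qed (use \<alpha> in auto)
      also have "\<dots> \<le> \<dots> + ennreal e" by simp
      finally show ?thesis .
    qed
    ultimately show ?thesis using cyl_sets unfolding T_def by blast
  qed
  have "ln N / ln (1 / r) \<le> \<alpha>" if \<alpha>: "0 < \<alpha>" and content: "hausdorff_content \<alpha> (\<phi> ` ?\<Omega>) d = 0" for \<alpha>
  proof (rule ccontr)
    assume "\<not> ln N / ln (1 / r) \<le> \<alpha>"
    then have less: "\<alpha> < ln N / ln (1 / r)" by simp
    have "hausdorff_content \<alpha> (\<phi> ` ?\<Omega>) d < ennreal (a powr \<alpha> / 4)"
      using content a by simp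
    then obtain A where cover: "\<phi> ` ?\<Omega> \<subseteq> (\<Union>i::nat. A i)"
      and sum: "(\<Sum>i. ennreal_powr (ediam d (A i)) \<alpha>) < ennreal (a powr \<alpha> / 4)"
      unfolding hausdorff_content_def INF_less_iff by blast
    \<comment> \<open>The errors \<open>1/4 * (1/2) ^ Suc i\<close> add up to \<open>1/4\<close>, and the main term is at most \<open>1/4\<close>.\<close>
    let ?bound = "\<lambda>i. ennreal (a powr - \<alpha>) * ennreal_powr (ediam d (A i)) \<alpha> + ennreal (1/4 * (1/2) ^ Suc i)"
    have "\<exists>C. \<forall>i. C i \<in> sets P \<and> {\<omega> \<in> ?\<Omega>. \<phi> \<omega> \<in> A i} \<subseteq> C i \<and> emeasure P (C i) \<le> ?bound i"
    proof (intro choice allI)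
      show "\<exists>C. C \<in> sets P \<and> {\<omega> \<in> ?\<Omega>. \<phi> \<omega> \<in> A i} \<subseteq> C \<and> emeasure P C \<le> ?bound i" for i
        using small_cylinder[OF \<alpha> less, of "1/4 * (1/2) ^ Suc i" "A i"] by auto
    qed
    then obtain C where C: "\<And>i. C i \<in> sets P" "\<And>i. {\<omega> \<in> ?\<Omega>. \<phi> \<omega> \<in> A i} \<subseteq> C i"
      "\<And>i. emeasure P (C i) \<le> ?bound i"
      by blast
    have "1 = emeasure P (space P)" by (simp add: emeasure_space_1)
    also have "\<dots> \<le> emeasure P (\<Union>i. C i)"
      using cover C(1,2) by (intro emeasure_mono) (auto simp: space, blast)
    also have "\<dots> \<le> (\<Sum>i. emeasure P (C i))"
      using C(1) by (intro emeasure_subadditive_countably) auto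
    also have "\<dots> \<le> (\<Sum>i. ?bound i)"
      using C(3) by (intro suminf_le) auto
    also have "\<dots> = ennreal (a powr - \<alpha>) * (\<Sum>i. ennreal_powr (ediam d (A i)) \<alpha>) + (\<Sum>i. ennreal (1/4 * (1/2) ^ Suc i))"
      by (simp add: ennreal_suminf_cmult flip: suminf_add)
    also have "(\<Sum>i. ennreal (1/4 * (1/2) ^ Suc i)) = ennreal (1/4)"
      using sums_mult[OF power_half_series, of "1/4"] by (intro suminf_ennreal_eq) auto
    also have "ennreal (a powr - \<alpha>) * (\<Sum>i. ennreal_powr (ediam d (A i)) \<alpha>)
        \<le> ennreal (a powr - \<alpha>) * ennreal (a powr \<alpha> / 4)"
      using sum by (intro mult_left_mono) auto
    also have "\<dots> = ennreal (1/4)"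
      using a by (simp add: powr_minus flip: ennreal_mult)
    finally have "ennreal 1 \<le> ennreal (1/4 + 1/4)"
      by (simp flip: ennreal_plus)
    then show False by (subst (asm) ennreal_le_iff) auto
  qed
  then show ?thesis
    unfolding hausdorff_dim_def by (intro Inf_greatest) (auto simp: N_def)
qed

text \<open>
  The ultrametric is the standard one of the code tree, \<open>b * r ^ k\<close> for codes that first differ at
  level \<open>k\<close>: the upper bound says that it dominates \<open>d\<close>, the lower one that it exceeds \<open>d\<close> by at
  most the factor \<open>b / a\<close>.
\<close>

lemma um_distortion_le_of_coding:
  fixes d :: "'a \<Rightarrow> 'a \<Rightarrow> real" and \<phi> :: "(nat \<Rightarrow> 'b) \<Rightarrow> 'a"
  assumes metric: "Metric_space X d" and sub: "\<phi> ` \<Omega> \<subseteq> X"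
    and r: "0 < r" "r < 1" and ab: "0 < a" "a \<le> b"
    and lower: "\<And>\<omega> \<omega>' k. \<omega> \<in> \<Omega> \<Longrightarrow> \<omega>' \<in> \<Omega> \<Longrightarrow> first_diff \<omega> \<omega>' k \<Longrightarrow> a * r ^ k \<le> d (\<phi> \<omega>) (\<phi> \<omega>')"
    and upper: "\<And>\<omega> \<omega>' k. \<omega> \<in> \<Omega> \<Longrightarrow> \<omega>' \<in> \<Omega> \<Longrightarrow> first_diff \<omega> \<omega>' k \<Longrightarrow> d (\<phi> \<omega>) (\<phi> \<omega>') \<le> b * r ^ k"
  shows "um_distortion (\<phi> ` \<Omega>) d \<le> ereal (b / a)"
proof -
  interpret Metric_space X d by (fact metric)
  let ?S = "\<phi> ` \<Omega>"
  have inj: "inj_on \<phi> \<Omega>"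
  proof (rule inj_onI, rule ccontr)
    fix \<omega> \<omega>' assume *: "\<omega> \<in> \<Omega>" "\<omega>' \<in> \<Omega>" "\<phi> \<omega> = \<phi> \<omega>'" "\<omega> \<noteq> \<omega>'"
    obtain k where "first_diff \<omega> \<omega>' k" using first_diff_exists *(4) by blast
    then have "a * r ^ k \<le> d (\<phi> \<omega>) (\<phi> \<omega>')" using * lower by blast
    moreover have "d (\<phi> \<omega>) (\<phi> \<omega>') = 0" using * sub by auto
    ultimately show False using mult_pos_pos[OF ab(1) zero_less_power[OF r(1), of k]] by linarith
  qed
  define code where "code = inv_into \<Omega> \<phi>"
  have code: "code x \<in> \<Omega>" "\<phi> (code x) = x" if "x \<in> ?S" for x
    using that by (auto simp: code_def inv_into_into f_inv_into_f)
  define level where "level x y = (LEAST k. code x k \<noteq> code y k)" for x y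
  define \<rho> where "\<rho> x y = (if x = y then 0 else b * r ^ level x y)" for x y
  have level: "first_diff (code x) (code y) (level x y)" if "x \<in> ?S" "y \<in> ?S" "x \<noteq> y" for x y
  proof -
    have "code x \<noteq> code y" using code that by metis
    then have "\<exists>k. code x k \<noteq> code y k" by auto
    from LeastI_ex[OF this] show ?thesis
      unfolding level_def first_diff_def using not_less_Least by blast
  qed
  have commute: "\<rho> x y = \<rho> y x" for x y
    by (auto simp: \<rho>_def level_def eq_commute)
  have nonneg: "0 \<le> \<rho> x y" for x y
    using ab r by (simp add: \<rho>_def)
  have ultra: "\<rho> x y \<le> max (\<rho> x z) (\<rho> y z)" if S: "x \<in> ?S" "y \<in> ?S" "z \<in> ?S" for x y z
  proof (cases "x = y \<or> x = z \<or> y = z")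
    case True
    then show ?thesis
      using nonneg[of x z] nonneg[of x y] commute[of x y] by (auto simp: \<rho>_def max_def)
  next
    case False
    then have "min (level x z) (level y z) \<le> level x y"
      using first_diff_ultra[OF level level level] S by blast
    then have "r ^ level x y \<le> r ^ min (level x z) (level y z)"
      using r by (intro power_decreasing) auto
    then have "b * r ^ level x y \<le> b * r ^ min (level x z) (level y z)"
      using ab by (intro mult_left_mono) auto
    then show ?thesis using False by (auto simp: \<rho>_def min_def max_def split: if_splits)
  qed
  have "ultrametric_on ?S \<rho>"
    unfolding ultrametric_on_def
  proof (intro conjI ballI ultra)
    show "Metric_space ?S \<rho>"
    proof
      show "\<rho> x z \<le> \<rho> x y + \<rho> y z" if "x \<in> ?S" "y \<in> ?S" "z \<in> ?S" for x y z
        using ultra[OF that(1,3,2)] nonneg[of x y] nonneg[of y z] commute[of y z] by (simp add: max_def split: if_splits)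
    qed (use ab r nonneg commute in \<open>auto simp: \<rho>_def\<close>)
  qed
  moreover have "d x y \<le> \<rho> x y \<and> \<rho> x y \<le> b / a * d x y" if S: "x \<in> ?S" "y \<in> ?S" for x y
  proof (cases "x = y")
    case True
    have "d x x = 0" using S sub by auto
    with True show ?thesis by (simp add: \<rho>_def)
  next
    case False
    note bounds = lower[OF code(1) code(1) level] upper[OF code(1) code(1) level]
    have lo: "a * r ^ level x y \<le> d x y" and up: "d x y \<le> b * r ^ level x y"
      using bounds[of x y] S False by (simp_all add: code)
    have "b * r ^ level x y = b / a * (a * r ^ level x y)" using ab by simp
    also have "\<dots> \<le> b / a * d x y" using lo ab by (intro mult_left_mono) auto
    finally show ?thesis using up False by (simp add: \<rho>_def)
  qed
  ultimately show ?thesis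
    unfolding um_distortion_def using ab by (intro Inf_lower imageI) (auto simp: pos_le_divide_eq)
qed

section \<open>Self-similar sets of digit expansions\<close>

definition digit_point :: "real \<Rightarrow> (nat \<Rightarrow> nat \<Rightarrow> real) \<Rightarrow> nat \<Rightarrow> real" where
  "digit_point r \<omega> = (\<lambda>j. \<Sum>k. r ^ k * \<omega> k j)"

lemma digit_summable:
  assumes "0 < r" "r < 1" and B: "\<And>v. v \<in> V \<Longrightarrow> \<bar>v j\<bar> \<le> B" and \<omega>: "\<omega> \<in> UNIV \<rightarrow> V"
  shows "summable (\<lambda>k. r ^ k * \<omega> k j)" and "\<bar>digit_point r \<omega> j\<bar> \<le> B / (1 - r)"
proof -
  have geo: "(\<lambda>k. B * r ^ k) sums (B * (1 / (1 - r)))"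
    using assms by (intro sums_mult geometric_sums) auto
  have le: "norm (r ^ k * \<omega> k j) \<le> B * r ^ k" for k
    using B[of "\<omega> k"] \<omega> assms(1,2) by (auto simp: abs_mult mult.commute[of B] intro!: mult_left_mono)
  show "summable (\<lambda>k. r ^ k * \<omega> k j)"
    by (rule summable_comparison_test'[of "\<lambda>k. B * r ^ k" 0]) (use geo le in \<open>auto simp: sums_iff\<close>)
  have "norm (digit_point r \<omega> j) \<le> (\<Sum>k. B * r ^ k)"
    unfolding digit_point_def by (rule norm_suminf_le) (use geo le in \<open>auto simp: sums_iff\<close>)
  then show "\<bar>digit_point r \<omega> j\<bar> \<le> B / (1 - r)"
    using geo by (simp add: sums_iff)
qed

lemma finite_coordinate_bound:
  fixes V :: "(nat \<Rightarrow> real) set"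
  assumes "finite V"
  obtains B where "\<And>v j. v \<in> V \<Longrightarrow> \<bar>v j\<bar> \<le> B j"
proof
  show "\<bar>v j\<bar> \<le> (\<Sum>v\<in>V. \<bar>v j\<bar>)" if "v \<in> V" for v j
    using assms that by (intro member_le_sum) auto
qed

text \<open>
  Self-similarity of the set of digit points, on which both distance estimates below rest.
\<close>

lemma digit_point_split:
  assumes "finite V" "0 < r" "r < 1" "\<omega> \<in> UNIV \<rightarrow> V"
  shows "digit_point r \<omega> j = \<omega> 0 j + r * digit_point r (\<lambda>k. \<omega> (Suc k)) j"
proof -
  obtain B where B: "\<And>v j. v \<in> V \<Longrightarrow> \<bar>v j\<bar> \<le> B j" using finite_coordinate_bound assms(1) by blast
  have sum: "summable (\<lambda>k. r ^ k * \<omega> k j)" "summable (\<lambda>k. r ^ k * \<omega> (Suc k) j)"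
    using assms(4) by (auto intro!: digit_summable(1)[OF assms(2,3) B])
  show ?thesis
    using suminf_split_head[OF sum(1)] suminf_mult[OF sum(2), of r]
    by (simp add: digit_point_def mult.assoc)
qed

lemma euclid_dist_add_scale:
  assumes "0 \<le> r"
  shows "euclid_dist n (\<lambda>j. v j + r * p j) (\<lambda>j. w j + r * q j) \<le> euclid_dist n v w + r * euclid_dist n p q"
    and "euclid_dist n v w - r * euclid_dist n p q \<le> euclid_dist n (\<lambda>j. v j + r * p j) (\<lambda>j. w j + r * q j)"
    and "euclid_dist n (\<lambda>j. v j + r * p j) (\<lambda>j. v j + r * q j) = r * euclid_dist n p q"
proof -
  have symm: "L2_set (\<lambda>j. q j - p j) {..<n} = L2_set (\<lambda>j. p j - q j) {..<n}"
    by (simp add: L2_set_def power2_commute)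
  have scale: "r * euclid_dist n p q = L2_set (\<lambda>j. r * (p j - q j)) {..<n}"
    "r * euclid_dist n p q = L2_set (\<lambda>j. r * (q j - p j)) {..<n}"
    using assms by (simp_all add: euclid_dist_def symm flip: L2_set_right_distrib)
  show "euclid_dist n (\<lambda>j. v j + r * p j) (\<lambda>j. w j + r * q j) \<le> euclid_dist n v w + r * euclid_dist n p q"
    using L2_set_triangle_ineq[of "\<lambda>j. v j - w j" "\<lambda>j. r * (p j - q j)" "{..<n}"]
    unfolding scale(1) by (simp add: euclid_dist_def algebra_simps)
  show "euclid_dist n v w - r * euclid_dist n p q \<le> euclid_dist n (\<lambda>j. v j + r * p j) (\<lambda>j. w j + r * q j)"
    using L2_set_triangle_ineq[of "\<lambda>j. (v j + r * p j) - (w j + r * q j)" "\<lambda>j. r * (q j - p j)" "{..<n}"]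
    unfolding scale(2) by (simp add: euclid_dist_def algebra_simps)
  show "euclid_dist n (\<lambda>j. v j + r * p j) (\<lambda>j. v j + r * q j) = r * euclid_dist n p q"
    unfolding scale(1) by (simp add: euclid_dist_def algebra_simps)
qed

text \<open>
  Let \<open>D\<close> be the diameter of the set of all digit points. Splitting off the first digit gives
  \<open>D \<le> M + r * D\<close>, and this can be solved for \<open>D\<close> once \<open>D\<close> is known to be finite, for which a crude
  bound on each coordinate suffices.
\<close>

lemma digit_point_dist_le:
  assumes V: "finite V" and r: "0 < r" "r < 1"
    and M: "\<And>v w. v \<in> V \<Longrightarrow> w \<in> V \<Longrightarrow> euclid_dist n v w \<le> M"
    and \<omega>: "\<omega> \<in> UNIV \<rightarrow> V" "\<omega>' \<in> UNIV \<rightarrow> V"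
  shows "euclid_dist n (digit_point r \<omega>) (digit_point r \<omega>') \<le> M / (1 - r)"
proof -
  let ?\<Omega> = "UNIV \<rightarrow> V :: (nat \<Rightarrow> nat \<Rightarrow> real) set"
  let ?d = "\<lambda>(\<omega>, \<omega>'). euclid_dist n (digit_point r \<omega>) (digit_point r \<omega>')"
  define D where "D = (SUP p\<in>?\<Omega> \<times> ?\<Omega>. ?d p)"
  obtain B where B: "\<And>v j. v \<in> V \<Longrightarrow> \<bar>v j\<bar> \<le> B j" using finite_coordinate_bound V by blast
  have bounded: "\<bar>digit_point r \<omega> j\<bar> \<le> B j / (1 - r)" if "\<omega> \<in> ?\<Omega>" for \<omega> j
    by (rule digit_summable(2)[OF r _ that]) (rule B)
  have "?d (\<omega>, \<omega>') \<le> (\<Sum>j<n. 2 * (B j / (1 - r)))" if "\<omega> \<in> ?\<Omega>" "\<omega>' \<in> ?\<Omega>" for \<omega> \<omega>'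
  proof -
    have "?d (\<omega>, \<omega>') \<le> (\<Sum>j<n. \<bar>digit_point r \<omega> j - digit_point r \<omega>' j\<bar>)"
      unfolding euclid_dist_def prod.case by (rule L2_set_le_sum_abs)
    also have "\<dots> \<le> (\<Sum>j<n. 2 * (B j / (1 - r)))"
    proof (rule sum_mono)
      fix j
      show "\<bar>digit_point r \<omega> j - digit_point r \<omega>' j\<bar> \<le> 2 * (B j / (1 - r))"
        using bounded[OF that(1), of j] bounded[OF that(2), of j] by linarith
    qed
    finally show ?thesis .
  qed
  then have bdd: "bdd_above (?d ` (?\<Omega> \<times> ?\<Omega>))"
    by (intro bdd_aboveI2[where M = "\<Sum>j<n. 2 * (B j / (1 - r))"]) auto
  have le_D: "?d (\<omega>, \<omega>') \<le> D" if "\<omega> \<in> ?\<Omega>" "\<omega>' \<in> ?\<Omega>" for \<omega> \<omega>'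
    unfolding D_def using bdd that by (intro cSUP_upper) auto
  have "D \<le> M + r * D"
    unfolding D_def
  proof (rule cSUP_least, goal_cases)
    case (2 p)
    then obtain \<omega> \<omega>' where p: "p = (\<omega>, \<omega>')" "\<omega> \<in> ?\<Omega>" "\<omega>' \<in> ?\<Omega>" by auto
    let ?t = "\<lambda>\<omega>. digit_point r (\<lambda>k. \<omega> (Suc k))"
    have "?d p = euclid_dist n (\<lambda>j. \<omega> 0 j + r * ?t \<omega> j) (\<lambda>j. \<omega>' 0 j + r * ?t \<omega>' j)"
      using digit_point_split[OF V r p(2)] digit_point_split[OF V r p(3)] p(1)
      by (simp add: euclid_dist_def)
    also have "\<dots> \<le> euclid_dist n (\<omega> 0) (\<omega>' 0) + r * euclid_dist n (?t \<omega>) (?t \<omega>')"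
      using r by (intro euclid_dist_add_scale) auto
    also have "\<dots> \<le> M + r * D"
      using p r le_D[of "\<lambda>k. \<omega> (Suc k)" "\<lambda>k. \<omega>' (Suc k)"]
      by (intro add_mono M mult_left_mono) auto
    finally show ?case by (simp add: D_def)
  qed (use \<omega> in blast)
  then have "D \<le> M / (1 - r)"
    using r by (simp add: pos_le_divide_eq algebra_simps)
  with le_D[OF \<omega>] show ?thesis by simp
qed

text \<open>
  An equal leading digit only scales the distance by \<open>r\<close>, which reduces the claim to \<open>k = 0\<close>. There
  the first digits contribute at least \<open>m\<close>, and the tails change this by at most \<open>r\<close> times the diameter.
\<close>

lemma digit_point_dist_first_diff:
  assumes V: "finite V" and r: "0 < r" "r < 1"
    and m: "\<And>v w. v \<in> V \<Longrightarrow> w \<in> V \<Longrightarrow> v \<noteq> w \<Longrightarrow> m \<le> euclid_dist n v w"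
    and M: "\<And>v w. v \<in> V \<Longrightarrow> w \<in> V \<Longrightarrow> euclid_dist n v w \<le> M"
    and \<omega>: "\<omega> \<in> UNIV \<rightarrow> V" "\<omega>' \<in> UNIV \<rightarrow> V" "first_diff \<omega> \<omega>' k"
  shows "(m - r * (M / (1 - r))) * r ^ k \<le> euclid_dist n (digit_point r \<omega>) (digit_point r \<omega>')
    \<and> euclid_dist n (digit_point r \<omega>) (digit_point r \<omega>') \<le> M / (1 - r) * r ^ k"
  using \<omega>
proof (induction k arbitrary: \<omega> \<omega>')
  case (0 \<omega> \<omega>')
  let ?t = "\<lambda>\<omega>. digit_point r (\<lambda>k. \<omega> (Suc k))"
  have tails: "euclid_dist n (?t \<omega>) (?t \<omega>') \<le> M / (1 - r)"
    using 0 by (intro digit_point_dist_le[OF V r M]) auto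
  have "m - r * (M / (1 - r)) \<le> euclid_dist n (\<omega> 0) (\<omega>' 0) - r * euclid_dist n (?t \<omega>) (?t \<omega>')"
    using 0 r tails by (intro diff_mono m mult_left_mono) (auto simp: first_diff_def)
  also have "\<dots> \<le> euclid_dist n (\<lambda>j. \<omega> 0 j + r * ?t \<omega> j) (\<lambda>j. \<omega>' 0 j + r * ?t \<omega>' j)"
    using r by (intro euclid_dist_add_scale) auto
  also have "\<dots> = euclid_dist n (digit_point r \<omega>) (digit_point r \<omega>')"
    using digit_point_split[OF V r 0(1)] digit_point_split[OF V r 0(2)] by (simp add: euclid_dist_def)
  finally show ?case
    using digit_point_dist_le[OF V r M 0(1,2)] by simp
next
  case (Suc k \<omega> \<omega>')
  let ?s = "\<lambda>\<omega> k. \<omega> (Suc k)"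
  have same: "\<omega> 0 = \<omega>' 0" and tail: "first_diff (?s \<omega>) (?s \<omega>') k"
    using Suc.prems(3) by (auto simp: first_diff_def)
  have "euclid_dist n (digit_point r \<omega>) (digit_point r \<omega>')
      = euclid_dist n (\<lambda>j. \<omega>' 0 j + r * digit_point r (?s \<omega>) j) (\<lambda>j. \<omega>' 0 j + r * digit_point r (?s \<omega>') j)"
    using digit_point_split[OF V r Suc.prems(1)] digit_point_split[OF V r Suc.prems(2)] same
    by (simp add: euclid_dist_def)
  also have "\<dots> = r * euclid_dist n (digit_point r (?s \<omega>)) (digit_point r (?s \<omega>'))"
    using r by (intro euclid_dist_add_scale) auto
  finally have eq: "euclid_dist n (digit_point r \<omega>) (digit_point r \<omega>')
    = r * euclid_dist n (digit_point r (?s \<omega>)) (digit_point r (?s \<omega>'))" .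
  have "(m - r * (M / (1 - r))) * r ^ k \<le> euclid_dist n (digit_point r (?s \<omega>)) (digit_point r (?s \<omega>'))"
    "euclid_dist n (digit_point r (?s \<omega>)) (digit_point r (?s \<omega>')) \<le> M / (1 - r) * r ^ k"
    using Suc.IH[OF _ _ tail] Suc.prems by auto
  from this[THEN mult_left_mono, of r] show ?case
    unfolding eq using r by (simp add: mult_ac)
qed

section \<open>Choice of the digits and the ratio\<close>

text \<open>
  The distortion \<open>b / a\<close> for \<open>M = (1 + \<epsilon>) * m\<close>. The choice \<open>r = \<epsilon>\<^sup>2\<close> is small enough for the tails
  to cost less than another factor \<open>1 + 2 * \<epsilon>\<close>, and it keeps \<open>ln (1/r)\<close> equal to \<open>2 * ln (1/\<epsilon>)\<close>.
\<close>

lemma distortion_ratio_le: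
  fixes \<epsilon> :: real
  assumes \<epsilon>: "0 < \<epsilon>" "\<epsilon> \<le> 1/4"
  defines "r \<equiv> \<epsilon>\<^sup>2"
  shows "0 < 1 - r - r * (1 + \<epsilon>)" "(1 + \<epsilon>) / (1 - r - r * (1 + \<epsilon>)) \<le> 1 + 3 * \<epsilon>"
proof -
  have "\<epsilon> * (2 + \<epsilon>) * (1 + 3 * \<epsilon>) \<le> 1/4 * (9/4) * (7/4)"
    using \<epsilon> by (intro mult_mono) auto
  then have "\<epsilon> * (\<epsilon> * (2 + \<epsilon>) * (1 + 3 * \<epsilon>)) \<le> \<epsilon> * 2"
    using \<epsilon> by (intro mult_left_mono) auto
  then have *: "1 + \<epsilon> \<le> (1 + 3 * \<epsilon>) * (1 - r - r * (1 + \<epsilon>))"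
    by (simp add: r_def algebra_simps power2_eq_square)
  show "0 < 1 - r - r * (1 + \<epsilon>)"
    by (rule zero_less_mult_pos[of "1 + 3 * \<epsilon>"]) (use * \<epsilon> in linarith)+
  with * show "(1 + \<epsilon>) / (1 - r - r * (1 + \<epsilon>)) \<le> 1 + 3 * \<epsilon>"
    by (simp add: pos_divide_le_eq)
qed

lemma large_nearly_ultrametric_subset:
  assumes n: "n \<ge> 1" and \<epsilon>: "0 < \<epsilon>" "\<epsilon> \<le> 1/4"
  obtains S where "S \<subseteq> euclid_carrier n" "um_distortion S (euclid_dist n) \<le> ereal (1 + 3 * \<epsilon>)"
    "hausdorff_dim S (euclid_dist n) \<ge> ereal (1/64 * (\<epsilon>\<^sup>2 / ln (1 / \<epsilon>)) * n)"
proof -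
  obtain V m where V: "V \<subseteq> euclid_carrier n" "finite V" "card V \<ge> 2" "ln (card V) \<ge> \<epsilon>\<^sup>2 * n / 32"
    and m: "m > 0"
    and dist: "\<And>v w. v \<in> V \<Longrightarrow> w \<in> V \<Longrightarrow> v \<noteq> w \<Longrightarrow>
      m \<le> euclid_dist n v w \<and> euclid_dist n v w \<le> (1 + \<epsilon>) * m"
    using nearly_equidistant_points[OF n, of \<epsilon>] \<epsilon> by auto
  interpret Metric_space "euclid_carrier n" "euclid_dist n" by (rule Metric_space_euclid)
  define r where "r = \<epsilon>\<^sup>2"
  define M where "M = (1 + \<epsilon>) * m"
  have "\<epsilon> * \<epsilon> \<le> 1/4 * (1/4)" using \<epsilon> by (intro mult_mono) auto
  then have r: "0 < r" "r < 1" using \<epsilon> by (auto simp: r_def power2_eq_square)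
  have M: "euclid_dist n v w \<le> M" if "v \<in> V" "w \<in> V" for v w
    using dist[OF that] that V(1) m \<epsilon> by (cases "v = w") (auto simp: M_def subset_iff)
  define a where "a = m - r * (M / (1 - r))"
  define b where "b = M / (1 - r)"
  note ratio = distortion_ratio_le[OF \<epsilon>, folded r_def]
  have a_eq: "a = m * (1 - r - r * (1 + \<epsilon>)) / (1 - r)"
    using r by (simp add: a_def M_def field_simps)
  have a: "0 < a" unfolding a_eq using m r ratio(1) by (intro divide_pos_pos mult_pos_pos) auto
  have ba: "b / a = (1 + \<epsilon>) / (1 - r - r * (1 + \<epsilon>))"
    unfolding a_eq b_def M_def using r m by simp
  let ?\<Omega> = "UNIV \<rightarrow> V :: (nat \<Rightarrow> nat \<Rightarrow> real) set"
  have lower: "a * r ^ k \<le> euclid_dist n (digit_point r \<omega>) (digit_point r \<omega>')"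
    and upper: "euclid_dist n (digit_point r \<omega>) (digit_point r \<omega>') \<le> b * r ^ k"
    if "\<omega> \<in> ?\<Omega>" "\<omega>' \<in> ?\<Omega>" "first_diff \<omega> \<omega>' k" for \<omega> \<omega>' k
    using digit_point_dist_first_diff[OF V(2) r _ M that, of m] dist by (auto simp: a_def b_def)
  have "m \<le> M" "M \<le> b" "a \<le> m"
    using m \<epsilon> r by (auto simp: M_def a_def b_def pos_le_divide_eq algebra_simps)
  then have ab: "a \<le> b" by linarith
  have sub: "digit_point r ` ?\<Omega> \<subseteq> euclid_carrier n"
  proof
    fix x assume "x \<in> digit_point r ` ?\<Omega>"
    then obtain \<omega> where \<omega>: "x = digit_point r \<omega>" "\<omega> \<in> ?\<Omega>" by blast
    have "\<omega> k j = 0" if "n \<le> j" for k j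
      using \<omega>(2) V(1) that by (auto simp: euclid_carrier_def topspace_Euclidean_space Pi_iff subset_iff)
    then show "x \<in> euclid_carrier n"
      by (simp add: \<omega>(1) euclid_carrier_def topspace_Euclidean_space digit_point_def)
  qed
  show thesis
  proof (rule that[OF sub])
    have "um_distortion (digit_point r ` ?\<Omega>) (euclid_dist n) \<le> ereal (b / a)"
      by (rule um_distortion_le_of_coding[OF Metric_space_euclid sub r a ab]; (rule lower upper; assumption))
    also have "\<dots> \<le> ereal (1 + 3 * \<epsilon>)" using ratio(2) by (simp add: ba)
    finally show "um_distortion (digit_point r ` ?\<Omega>) (euclid_dist n) \<le> ereal (1 + 3 * \<epsilon>)" .
    have "ln (1 / r) = 2 * ln (1 / \<epsilon>)"
      using \<epsilon> by (simp add: r_def ln_div ln_realpow)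
    moreover have "0 < ln (1 / \<epsilon>)" using \<epsilon> by simp
    ultimately have "1/64 * (\<epsilon>\<^sup>2 / ln (1 / \<epsilon>)) * n = \<epsilon>\<^sup>2 * n / 32 / ln (1 / r)"
      by (simp add: field_simps)
    also have "\<dots> \<le> ln (card V) / ln (1 / r)"
      using V(4) r by (intro divide_right_mono) auto
    finally have "ereal (1/64 * (\<epsilon>\<^sup>2 / ln (1 / \<epsilon>)) * n) \<le> ereal (ln (card V) / ln (1 / r))"
      by simp
    also have "\<dots> \<le> hausdorff_dim (digit_point r ` ?\<Omega>) (euclid_dist n)"
      by (rule hausdorff_dim_ge_of_coding[OF V(2,3) r a]; (rule lower; assumption))
    finally show "hausdorff_dim (digit_point r ` ?\<Omega>) (euclid_dist n)
      \<ge> ereal (1/64 * (\<epsilon>\<^sup>2 / ln (1 / \<epsilon>)) * n)" .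
  qed
qed

theorem proposition3:
  shows "\<exists>c::real. c > 0 \<and>
    (\<forall>(\<epsilon>::real) n::nat. 0 \<le> \<epsilon> \<and> \<epsilon> \<le> 1/4 \<and> n \<ge> 1 \<longrightarrow>
      (\<exists>S. S \<subseteq> euclid_carrier n \<and>
           um_distortion S (euclid_dist n) \<le> ereal (1 + 3 * \<epsilon>) \<and>
           hausdorff_dim S (euclid_dist n)
             \<ge> ereal (c * (if \<epsilon> = 0 then 0 else \<epsilon>\<^sup>2 / ln (1 / \<epsilon>)) * real n)))"
proof (intro exI[of _ "1/64"] conjI allI impI)
  fix \<epsilon> :: real and n :: nat
  assume *: "0 \<le> \<epsilon> \<and> \<epsilon> \<le> 1/4 \<and> n \<ge> 1"
  \<comment> \<open>The constant is the \<open>1/32\<close> of the bound on \<open>ln (card V)\<close>, halved by \<open>ln (1/\<epsilon>\<^sup>2) = 2 * ln (1/\<epsilon>)\<close>.\<close>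
  show "\<exists>S. S \<subseteq> euclid_carrier n \<and> um_distortion S (euclid_dist n) \<le> ereal (1 + 3 * \<epsilon>) \<and>
      hausdorff_dim S (euclid_dist n)
        \<ge> ereal (1/64 * (if \<epsilon> = 0 then 0 else \<epsilon>\<^sup>2 / ln (1 / \<epsilon>)) * real n)"
  proof (cases "\<epsilon> = 0")
    case True
    let ?S = "{\<lambda>_. 0} :: (nat \<Rightarrow> real) set"
    have sub: "?S \<subseteq> euclid_carrier n"
      by (simp add: euclid_carrier_def topspace_Euclidean_space)
    then have "ultrametric_on ?S (euclid_dist n)"
      unfolding ultrametric_on_def using Metric_space.subspace[OF Metric_space_euclid] by auto
    then have "um_distortion ?S (euclid_dist n) \<le> ereal 1"
      unfolding um_distortion_def by (intro Inf_lower imageI) auto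
    moreover have "0 \<le> hausdorff_dim ?S (euclid_dist n)"
      unfolding hausdorff_dim_def by (intro Inf_greatest) auto
    ultimately show ?thesis using sub True by (intro exI[of _ ?S]) (auto simp: one_ereal_def zero_ereal_def)
  next
    case False
    obtain S where "S \<subseteq> euclid_carrier n" "um_distortion S (euclid_dist n) \<le> ereal (1 + 3 * \<epsilon>)"
      "hausdorff_dim S (euclid_dist n) \<ge> ereal (1/64 * (\<epsilon>\<^sup>2 / ln (1 / \<epsilon>)) * n)"
      by (rule large_nearly_ultrametric_subset[of n \<epsilon>]) (use * False in auto)
    then show ?thesis using False by auto
  qed
qed simp

end
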